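(* Let $n\ge 0$ and $m>1$ be integers, and let $d_{n+2}=|D_{n+2}|$. Then $$d_{n+2}\equiv G(D_n\times D_n)\equiv G(E_{n,m}^c\times E_{n,m}^c)\pmod m$$ and $$d_{n+2}\equiv\sum_{x\in R_n\cap E^c_{n,m}}\ \sum_{y\in E^c_{n,m}}\gamma(x)\cdot G(x,y)\pmod m.$$
   Context: $D_n$ is the set of monotone Boolean functions $\{0,1\}^n\to\{0,1\}$ ($\{0,1\}^n$ ordered componentwise), partially ordered pointwise. $\top,\bot$ are the constant functions $1,0$; $x|y$ and $x\&y$ are pointwise max and min; $\mathrm{re}(x,y)=|\{z\in D_n:x\le z\le y\}|$. For $x,y\in D_n$, $G(x,y)=\mathrm{re}(x|y,\top)\cdot\mathrm{re}(\bot,x\&y)$, and for $A\subseteq D_n\times D_n$, $G(A)=\sum_{(x,y)\in A}G(x,y)$. A permutation $\pi\in S_n$ acts on $g\in D_n$ by $\pi(g)=g\circ\pi$ where $\pi(u)=u\circ\pi$ for $u\in\{0,1\}^n$. $f\sim g$ iff $f=\pi(g)$ for some $\pi\in S_n$; $[f]$ is the class of $f$ and $\gamma(f)=|[f]|$. $E_{n,m}=\{f\in D_n:\gamma(f)\equiv0\pmod m\}$ and $E^c_{n,m}=D_n\setminus E_{n,m}$. $R_n$ is the set of equivalence classes, each identified with its canonical representative, namely its minimal element with respect to a fixed total order on $D_n$ (the paper uses the order obtained by reading the truth table of a function as a binary integer); thus $R_n\subseteq D_n$ contains exactly one element of each class. *)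

theory Defs
  imports
    "HOL-Library.FuncSet"
    "HOL-Combinatorics.Permutations"
    "HOL-Number_Theory.Cong"
begin

text \<open>
  Functions are extensional: points of the cube are \<^term>\<open>undefined\<close> outside \<open>{..<n}\<close>, and
  elements of \<open>D n\<close> are \<^term>\<open>undefined\<close> outside the cube. Two such functions
  agree off their domain, so the order and the lattice operations of the function type
  are exactly the pointwise ones on the domain.
\<close>

definition cube :: "nat \<Rightarrow> (nat \<Rightarrow> bool) set" where
  "cube n = ({..<n} \<rightarrow>\<^sub>E (UNIV :: bool set))"

definition D :: "nat \<Rightarrow> ((nat \<Rightarrow> bool) \<Rightarrow> bool) set" where
  "D n = {f \<in> cube n \<rightarrow>\<^sub>E (UNIV :: bool set). mono_on (cube n) f}"

definition top_D :: "nat \<Rightarrow> (nat \<Rightarrow> bool) \<Rightarrow> bool" where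
  "top_D n = (\<lambda>u\<in>cube n. True)"

definition bot_D :: "nat \<Rightarrow> (nat \<Rightarrow> bool) \<Rightarrow> bool" where
  "bot_D n = (\<lambda>u\<in>cube n. False)"

definition re :: "nat \<Rightarrow> ((nat \<Rightarrow> bool) \<Rightarrow> bool) \<Rightarrow> ((nat \<Rightarrow> bool) \<Rightarrow> bool) \<Rightarrow> nat" where
  "re n x y = card {z \<in> D n. x \<le> z \<and> z \<le> y}"

definition G :: "nat \<Rightarrow> ((nat \<Rightarrow> bool) \<Rightarrow> bool) \<Rightarrow> ((nat \<Rightarrow> bool) \<Rightarrow> bool) \<Rightarrow> nat" where
  "G n x y = re n (sup x y) (top_D n) * re n (bot_D n) (inf x y)"

definition G_sum ::
    "nat \<Rightarrow> (((nat \<Rightarrow> bool) \<Rightarrow> bool) \<times> ((nat \<Rightarrow> bool) \<Rightarrow> bool)) set \<Rightarrow> nat" where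
  "G_sum n A = (\<Sum>(x, y)\<in>A. G n x y)"

text \<open>
  No restriction is needed in the action: if \<open>p permutes {..<n}\<close>, then \<open>u \<circ> p\<close> lies in
  \<open>cube n\<close> iff \<open>u\<close> does.
\<close>

definition act ::
    "(nat \<Rightarrow> nat) \<Rightarrow> ((nat \<Rightarrow> bool) \<Rightarrow> bool) \<Rightarrow> (nat \<Rightarrow> bool) \<Rightarrow> bool" where
  "act p g = g \<circ> (\<lambda>u. u \<circ> p)"

definition sim :: "nat \<Rightarrow> (((nat \<Rightarrow> bool) \<Rightarrow> bool) \<times> ((nat \<Rightarrow> bool) \<Rightarrow> bool)) set" where
  "sim n = {(f, g). f \<in> D n \<and> g \<in> D n \<and> (\<exists>p. p permutes {..<n} \<and> f = act p g)}"

definition gam :: "nat \<Rightarrow> ((nat \<Rightarrow> bool) \<Rightarrow> bool) \<Rightarrow> nat" where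
  "gam n f = card (sim n `` {f})"

definition E :: "nat \<Rightarrow> nat \<Rightarrow> ((nat \<Rightarrow> bool) \<Rightarrow> bool) set" where
  "E n m = {f \<in> D n. [gam n f = 0] (mod m)}"

definition Ec :: "nat \<Rightarrow> nat \<Rightarrow> ((nat \<Rightarrow> bool) \<Rightarrow> bool) set" where
  "Ec n m = D n - E n m"

text \<open>
  The representatives depend on the chosen total order \<open>r\<close> on \<open>D n\<close>; comparing truth tables
  as binary integers is one such choice.
\<close>

definition R ::
    "nat \<Rightarrow> (((nat \<Rightarrow> bool) \<Rightarrow> bool) \<times> ((nat \<Rightarrow> bool) \<Rightarrow> bool)) set
      \<Rightarrow> ((nat \<Rightarrow> bool) \<Rightarrow> bool) set" where
  "R n r = {f. \<exists>C \<in> D n // sim n. f \<in> C \<and> (\<forall>g\<in>C. (f, g) \<in> r)}"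

lemma le_D_iff:
  assumes "f \<in> D n" "g \<in> D n"
  shows "f \<le> g \<longleftrightarrow> (\<forall>u\<in>cube n. f u \<le> g u)"
  using assms unfolding D_def le_fun_def PiE_def extensional_def by fastforce

lemma le_cube_iff:
  assumes "u \<in> cube n" "v \<in> cube n"
  shows "u \<le> v \<longleftrightarrow> (\<forall>i<n. u i \<le> v i)"
  using assms unfolding cube_def le_fun_def PiE_def extensional_def
  by (auto simp: not_less) (metis not_le)

lemma sup_in_D: "f \<in> D n \<Longrightarrow> g \<in> D n \<Longrightarrow> sup f g \<in> D n"
  unfolding D_def PiE_def extensional_def mono_on_def by auto

lemma inf_in_D: "f \<in> D n \<Longrightarrow> g \<in> D n \<Longrightarrow> inf f g \<in> D n"
  unfolding D_def PiE_def extensional_def mono_on_def by auto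

lemma comp_in_cube_iff:
  assumes "p permutes {..<n}"
  shows "u \<circ> p \<in> cube n \<longleftrightarrow> u \<in> cube n"
proof -
  have "(\<forall>i. i \<notin> {..<n} \<longrightarrow> u (p i) = undefined) \<longleftrightarrow> (\<forall>i. i \<notin> {..<n} \<longrightarrow> u i = undefined)"
    using permutes_not_in[OF assms] by auto
  then show ?thesis by (auto simp: cube_def PiE_def extensional_def)
qed

lemma act_in_D:
  assumes "p permutes {..<n}" "g \<in> D n"
  shows "act p g \<in> D n"
proof -
  note cube_iff = comp_in_cube_iff[OF assms(1)]
  have "act p g \<in> cube n \<rightarrow>\<^sub>E UNIV"
    using assms(2) cube_iff by (simp add: D_def act_def PiE_def extensional_def)
  moreover have "mono_on (cube n) (act p g)"
  proof (rule mono_onI)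
    fix u v assume uv: "u \<in> cube n" "v \<in> cube n" "u \<le> v"
    then have "u \<circ> p \<le> v \<circ> p" by (simp add: le_fun_def)
    moreover have "mono_on (cube n) g" using assms(2) by (simp add: D_def)
    ultimately have "g (u \<circ> p) \<le> g (v \<circ> p)" using uv cube_iff by (blast dest: mono_onD)
    then show "act p g u \<le> act p g v" by (simp add: act_def)
  qed
  ultimately show ?thesis by (simp add: D_def)
qed

end

theory Submission
  imports Defs
begin

text \<open>
  Cutting a monotone function at its last coordinate identifies \<open>D (n + 1)\<close> with the pairs
  \<open>a \<le> b\<close> in \<open>D n\<close>, as an ordered set. Doing this twice identifies \<open>D (n + 2)\<close> with the
  quadruples \<open>a \<le> x, y \<le> b\<close>; once the two middle functions are fixed, \<open>a\<close> ranges
  over the interval below \<open>x \<sqinter> y\<close> and \<open>b\<close> over the one above \<open>x \<squnion> y\<close>, which gives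
  \<open>d\<^sub>n\<^sub>+\<^sub>2 = G(D\<^sub>n \<times> D\<^sub>n)\<close> exactly. Since \<open>G\<close> is invariant under the diagonal action, each of
  its marginal sums over a union of orbits is constant on orbits, so an orbit in \<open>E\<close> contributes
  a multiple of \<open>m\<close>; this removes \<open>E\<close> first from one argument and then from the other.
\<close>

subsection \<open>Cutting at the last coordinate\<close>

lemma finite_cube: "finite (cube n)"
  unfolding cube_def by (intro finite_PiE) auto

lemma finite_D: "finite (D n)"
  unfolding D_def by (rule finite_subset[OF _ finite_PiE[OF finite_cube]]) auto

lemma D_eqI:
  assumes "f \<in> D n" "g \<in> D n" "\<And>u. u \<in> cube n \<Longrightarrow> f u = g u"
  shows "f = g"
  using assms unfolding D_def by (auto intro: PiE_ext)

lemma D_monoD: "f \<in> D n \<Longrightarrow> u \<in> cube n \<Longrightarrow> v \<in> cube n \<Longrightarrow> u \<le> v \<Longrightarrow> f u \<le> f v"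
  unfolding D_def by (auto dest: mono_onD)

lemma restrict_in_DI:
  assumes "\<And>u v. u \<in> cube n \<Longrightarrow> v \<in> cube n \<Longrightarrow> u \<le> v \<Longrightarrow> f u \<le> f v"
  shows "(\<lambda>u\<in>cube n. f u) \<in> D n"
  using assms unfolding D_def by (auto intro!: mono_onI)

lemma cube_extend: "u \<in> cube n \<Longrightarrow> u(n := i) \<in> cube (Suc n)"
  unfolding cube_def PiE_def extensional_def by auto

lemma cube_truncate: "v \<in> cube (Suc n) \<Longrightarrow> v(n := undefined) \<in> cube n"
  unfolding cube_def PiE_def extensional_def by auto

lemma cube_truncate_extend: "u \<in> cube n \<Longrightarrow> u(n := undefined) = u"
  unfolding cube_def PiE_def extensional_def by (simp add: fun_upd_idem)

definition slice :: "nat \<Rightarrow> bool \<Rightarrow> ((nat \<Rightarrow> bool) \<Rightarrow> bool) \<Rightarrow> (nat \<Rightarrow> bool) \<Rightarrow> bool" where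
  "slice n i f = (\<lambda>u\<in>cube n. f (u(n := i)))"

text \<open>The reset of coordinate \<open>n\<close> to \<open>undefined\<close> brings the argument
  back into \<open>cube n\<close>, whose points take that value outside \<open>{..<n}\<close>; only
  there are the values of \<open>a\<close> and \<open>b\<close> meaningful.\<close>

definition glue ::
    "nat \<Rightarrow> ((nat \<Rightarrow> bool) \<Rightarrow> bool) \<Rightarrow> ((nat \<Rightarrow> bool) \<Rightarrow> bool) \<Rightarrow> (nat \<Rightarrow> bool) \<Rightarrow> bool" where
  "glue n a b = (\<lambda>v\<in>cube (Suc n). (if v n then b else a) (v(n := undefined)))"

lemma slice_in_D:
  assumes "f \<in> D (Suc n)"
  shows "slice n i f \<in> D n"
  unfolding slice_def
  by (rule restrict_in_DI, rule D_monoD[OF assms])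
    (auto simp: cube_extend le_fun_def)

lemma slice_mono:
  assumes "f \<in> D (Suc n)"
  shows "slice n False f \<le> slice n True f"
proof -
  have "f (u(n := False)) \<le> f (u(n := True))" if "u \<in> cube n" for u
    using that by (intro D_monoD[OF assms]) (auto simp: cube_extend le_fun_def)
  then show ?thesis by (auto simp: slice_def le_fun_def)
qed

lemma glue_in_D:
  assumes "a \<in> D n" "b \<in> D n" "a \<le> b"
  shows "glue n a b \<in> D (Suc n)"
  unfolding glue_def
proof (rule restrict_in_DI)
  fix u v assume uv: "u \<in> cube (Suc n)" "v \<in> cube (Suc n)" "u \<le> v"
  let ?u = "u(n := undefined)" and ?v = "v(n := undefined)"
  have "?u \<le> ?v" using uv(3) by (auto simp: le_fun_def)
  then have "a ?u \<le> a ?v" "b ?u \<le> b ?v"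
    using uv assms by (blast intro: D_monoD cube_truncate)+
  \<comment> \<open>This is where \<open>a \<le> b\<close> enters: it settles the case in which the
    last coordinate rises from \<open>False\<close> to \<open>True\<close>.\<close>
  moreover have "a ?v \<le> b ?v" using assms(3) by (rule le_funD)
  moreover have "u n \<le> v n" using uv(3) by (rule le_funD)
  ultimately show "(if u n then b else a) ?u \<le> (if v n then b else a) ?v"
    by auto
qed

lemma slice_glue:
  assumes "a \<in> D n" "b \<in> D n" "a \<le> b"
  shows "slice n False (glue n a b) = a" "slice n True (glue n a b) = b"
  by (rule D_eqI[OF slice_in_D[OF glue_in_D[OF assms]]];
      use assms in \<open>simp add: slice_def glue_def cube_extend cube_truncate_extend\<close>)+

text \<open>Together the two slices see every point of \<open>cube (Suc n)\<close>. Through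
  antisymmetry this also shows that the slices determine the function, which gives injectivity of
  the cuts below.\<close>

lemma le_iff_slice:
  assumes "f \<in> D (Suc n)" "g \<in> D (Suc n)"
  shows "f \<le> g \<longleftrightarrow> slice n False f \<le> slice n False g \<and> slice n True f \<le> slice n True g"
proof (intro iffI conjI)
  assume "slice n False f \<le> slice n False g \<and> slice n True f \<le> slice n True g"
  then have sl: "slice n i f \<le> slice n i g" for i by (cases i) auto
  \<comment> \<open>Resetting coordinate \<open>n\<close> of \<open>v\<close> and then writing
    \<open>v n\<close> there gives \<open>v\<close> back, so the value at \<open>v\<close> is read
    off the slice selected by \<open>v n\<close>.\<close>
  have "f v \<le> g v" if "v \<in> cube (Suc n)" for v
    using le_funD[OF sl[of "v n"], of "v(n := undefined)"] cube_truncate[OF that]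
    by (simp add: slice_def)
  then show "f \<le> g" using le_D_iff[OF assms] by blast
qed (auto simp: slice_def le_fun_def)

lemma bij_betw_slices:
  "bij_betw (\<lambda>f. (slice n False f, slice n True f)) (D (Suc n))
    {(a, b). a \<in> D n \<and> b \<in> D n \<and> a \<le> b}"
proof (rule bij_betw_imageI)
  show "inj_on (\<lambda>f. (slice n False f, slice n True f)) (D (Suc n))"
    by (rule inj_onI) (simp add: antisym le_iff_slice)
  show "(\<lambda>f. (slice n False f, slice n True f)) ` D (Suc n)
      = {(a, b). a \<in> D n \<and> b \<in> D n \<and> a \<le> b}"
  proof safe
    fix a b assume "a \<in> D n" "b \<in> D n" "a \<le> b"
    then show "(a, b) \<in> (\<lambda>f. (slice n False f, slice n True f)) ` D (Suc n)"
      using slice_glue glue_in_D by (intro image_eqI[of _ _ "glue n a b"]) auto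
  qed (use slice_in_D slice_mono in blast)+
qed

section \<open>Counting quadruples of slices\<close>

lemma top_D_greatest: "f \<in> D n \<Longrightarrow> f \<le> top_D n"
  by (auto simp: top_D_def D_def PiE_def extensional_def le_fun_def)

lemma bot_D_least: "f \<in> D n \<Longrightarrow> bot_D n \<le> f"
  by (auto simp: bot_D_def D_def PiE_def extensional_def le_fun_def)

lemma card_D_add_2: "card (D (n + 2)) = G_sum n (D n \<times> D n)"
proof -
  let ?P = "{(f, g). f \<in> D (Suc n) \<and> g \<in> D (Suc n) \<and> f \<le> g}"
  let ?s = "\<lambda>f. (slice n False f, slice n True f)"
  let ?I = "\<lambda>(x, y). {a \<in> D n. bot_D n \<le> a \<and> a \<le> inf x y}
    \<times> {b \<in> D n. sup x y \<le> b \<and> b \<le> top_D n}"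
  let ?Q = "Sigma (D n \<times> D n) ?I"
  \<comment> \<open>For \<open>f \<le> g\<close> the lower slice of \<open>f\<close> is the least of
    the four and the upper slice of \<open>g\<close> the greatest. The other two need not be
    comparable; they become the index \<open>(x, y)\<close> of the fibre.\<close>
  let ?h = "\<lambda>(f, g). ((slice n True f, slice n False g), (slice n False f, slice n True g))"
  have "bij_betw ?h ?P ?Q"
  proof (rule bij_betw_imageI)
    show "inj_on ?h ?P"
      by (rule inj_onI) (clarsimp simp: antisym le_iff_slice)
    show "?h ` ?P = ?Q"
    proof (intro equalityI subsetI)
      fix q assume "q \<in> ?h ` ?P"
      then obtain f g where fg: "f \<in> D (Suc n)" "g \<in> D (Suc n)" "f \<le> g" "q = ?h (f, g)"
        by auto
      then show "q \<in> ?Q"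
        using slice_mono[OF fg(1)] slice_mono[OF fg(2)] le_iff_slice[OF fg(1,2)]
        by (simp add: slice_in_D top_D_greatest bot_D_least)
    next
      fix q assume "q \<in> ?Q"
      then obtain x y a b where q: "q = ((x, y), (a, b))"
        and D: "x \<in> D n" "y \<in> D n" "a \<in> D n" "b \<in> D n"
        and le: "a \<le> x" "a \<le> y" "x \<le> b" "y \<le> b"
        by (auto simp del: le_fun_def le_bool_def)
      \<comment> \<open>The inverse of \<open>?h\<close>: the function with slices \<open>a\<close>,
        \<open>x\<close> lies below the one with slices \<open>y\<close>, \<open>b\<close>, since
        \<open>a \<le> y\<close> and \<open>x \<le> b\<close>.\<close>
      note fg = glue_in_D[OF D(3,1) le(1)] glue_in_D[OF D(2,4) le(4)]
      have "glue n a x \<le> glue n y b"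
        using D le by (simp add: le_iff_slice[OF fg] slice_glue)
      then show "q \<in> ?h ` ?P"
        using D le fg by (intro image_eqI[of _ _ "(glue n a x, glue n y b)"]) (simp_all add: q slice_glue)
    qed
  qed
  then have "card ?P = card ?Q" by (rule bij_betw_same_card)
  also have "\<dots> = (\<Sum>p\<in>D n \<times> D n. card (?I p))"
    by (rule card_SigmaI) (auto simp: finite_D)
  also have "\<dots> = G_sum n (D n \<times> D n)"
    unfolding G_sum_def by (rule sum.cong) (auto simp: G_def re_def card_cartesian_product)
  finally show ?thesis
    using bij_betw_same_card[OF bij_betw_slices[of "Suc n"]] by simp
qed

subsection \<open>Invariance under coordinate permutations\<close>

text \<open>Precomposition happens twice, on points and on functions, so the two reversals cancel
  and the action is a left action.\<close>

lemma act_act: "act p (act q g) = act (p \<circ> q) g"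
  by (simp add: act_def fun_eq_iff comp_assoc)

lemma act_id: "act id g = g"
  by (simp add: act_def fun_eq_iff)

lemma act_inv:
  assumes "p permutes S"
  shows "act p (act (inv p) g) = g" "act (inv p) (act p g) = g"
  using permutes_inv_o[OF assms] by (simp_all add: act_act act_id)

text \<open>Each \<open>act q\<close> is monotone because the order is pointwise; applying this to
  \<open>p\<close> and to \<open>inv p\<close> gives both directions.\<close>

lemma act_le_iff:
  assumes "p permutes S"
  shows "act p x \<le> act p y \<longleftrightarrow> x \<le> y"
proof -
  have mono: "act q f \<le> act q g" if "f \<le> g" for q f g
    using that by (simp add: act_def le_fun_def)
  show ?thesis using mono[of x y p] mono[of "act p x" "act p y" "inv p"]
    by (auto simp: act_inv[OF assms])
qed

lemma bij_betw_act:
  assumes "p permutes {..<n}"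
  shows "bij_betw (act p) (D n) (D n)"
  by (rule bij_betw_byWitness[where f' = "act (inv p)"])
    (auto simp: act_inv[OF assms] act_in_D[OF assms] act_in_D[OF permutes_inv[OF assms]])

text \<open>\<open>act p\<close> is an order automorphism of \<open>D n\<close>, hence carries
  intervals bijectively onto intervals.\<close>

lemma re_act:
  assumes "p permutes {..<n}"
  shows "re n (act p x) (act p y) = re n x y"
proof -
  have "bij_betw (act p) {z \<in> D n. x \<le> z \<and> z \<le> y} {z \<in> D n. act p x \<le> z \<and> z \<le> act p y}"
  proof (rule bij_betw_subset[OF bij_betw_act[OF assms]])
    show "act p ` {z \<in> D n. x \<le> z \<and> z \<le> y} = {z \<in> D n. act p x \<le> z \<and> z \<le> act p y}"
    proof (intro equalityI subsetI)
      fix z assume "z \<in> {z \<in> D n. act p x \<le> z \<and> z \<le> act p y}"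
      moreover obtain w where "w \<in> D n" "z = act p w"
        using calculation bij_betw_imp_surj_on[OF bij_betw_act[OF assms]] by blast
      ultimately show "z \<in> act p ` {z \<in> D n. x \<le> z \<and> z \<le> y}"
        by (simp add: act_le_iff[OF assms])
    qed (use act_le_iff[OF assms] act_in_D[OF assms] in blast)
  qed auto
  then show ?thesis unfolding re_def by (rule bij_betw_same_card[symmetric])
qed

lemma G_act:
  assumes "p permutes {..<n}"
  shows "G n (act p x) (act p y) = G n x y"
proof -
  have "sup (act p x) (act p y) = act p (sup x y)" "inf (act p x) (act p y) = act p (inf x y)"
    by (simp_all add: act_def fun_eq_iff)
  \<comment> \<open>The cube is invariant under the permutation, so the constants are fixed even off
    the cube, where they are \<open>undefined\<close>.\<close>
  moreover have "act p (top_D n) = top_D n" "act p (bot_D n) = bot_D n"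
    by (simp_all add: act_def top_D_def bot_D_def fun_eq_iff comp_in_cube_iff[OF assms])
  ultimately show ?thesis
    unfolding G_def using re_act[OF assms] by metis
qed

lemma G_commute: "G n x y = G n y x"
  by (simp add: G_def sup_commute inf_commute)

subsection \<open>Orbit sums\<close>

lemma equiv_sim: "equiv (D n) (sim n)"
proof (rule equivI)
  show "sim n \<subseteq> D n \<times> D n" by (auto simp: sim_def)
  show "refl_on (D n) (sim n)"
    by (rule refl_onI) (auto simp: sim_def act_id intro!: exI[of _ id] permutes_id)
  show "sym (sim n)"
  proof (rule symI)
    fix f g assume "(f, g) \<in> sim n"
    then obtain p where "f \<in> D n" "g \<in> D n" "p permutes {..<n}" "f = act p g"
      by (auto simp: sim_def)
    then show "(g, f) \<in> sim n"
      by (auto simp: sim_def act_inv intro!: exI[of _ "inv p"] permutes_inv)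
  qed
  show "trans (sim n)"
  proof (rule transI)
    fix f g h assume "(f, g) \<in> sim n" "(g, h) \<in> sim n"
    then obtain p q where "f \<in> D n" "h \<in> D n" "p permutes {..<n}" "q permutes {..<n}"
      "f = act p (act q h)"
      by (auto simp: sim_def)
    then show "(f, h) \<in> sim n"
      by (auto simp: sim_def act_act intro!: exI[of _ "p \<circ> q"] permutes_compose)
  qed
qed

lemma sim_Image_eq: "(f, g) \<in> sim n \<Longrightarrow> sim n `` {f} = sim n `` {g}"
  by (rule equiv_class_eq[OF equiv_sim])

section \<open>Canonical representatives and orbit decomposition\<close>

lemma linear_order_on_ex_min:
  assumes "linear_order_on A r" "finite C" "C \<noteq> {}" "C \<subseteq> A"
  shows "\<exists>f\<in>C. \<forall>g\<in>C. (f, g) \<in> r"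
  using assms(2-4)
proof (induction C rule: finite_ne_induct)
  case (singleton x)
  then show ?case
    using assms(1) by (auto simp: order_on_defs dest: refl_onD)
next
  case (insert x F)
  then obtain f where f: "f \<in> F" "\<forall>g\<in>F. (f, g) \<in> r" by auto
  have tr: "trans r" and "refl_on A r" "total_on A r"
    using assms(1) by (auto simp: order_on_defs)
  then have xx: "(x, x) \<in> r" and "(x, f) \<in> r \<or> (f, x) \<in> r"
    using insert.prems f(1) by (simp, meson refl_onD, metis insert_subset refl_onD subsetD total_on_def)
  then show ?case
  proof (elim disjE)
    assume "(x, f) \<in> r"
    then have "\<forall>g\<in>insert x F. (x, g) \<in> r" using xx f(2) transD[OF tr] by blast
    then show ?thesis by blast
  qed (use f in blast)
qed

lemma R_minimal:
  assumes "f \<in> R n r" "(f, g) \<in> sim n"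
  shows "(f, g) \<in> r"
proof -
  from assms(1) obtain C where C: "C \<in> D n // sim n" "f \<in> C" "\<forall>g\<in>C. (f, g) \<in> r"
    by (auto simp: R_def)
  then show ?thesis
    using in_quotient_imp_closed[OF equiv_sim C(1,2) assms(2)] by blast
qed

text \<open>An orbit is a finite nonempty subset of \<open>D n\<close>, so it has a least element
  for \<open>r\<close>.\<close>

lemma ex_representative:
  assumes "linear_order_on (D n) r" "x \<in> D n"
  shows "\<exists>f\<in>R n r. (f, x) \<in> sim n"
proof -
  let ?C = "sim n `` {x}"
  have "?C \<subseteq> D n" by (auto simp: sim_def)
  moreover have "x \<in> ?C" using equiv_class_self[OF equiv_sim assms(2)] .
  ultimately obtain f where f: "f \<in> ?C" "\<forall>g\<in>?C. (f, g) \<in> r"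
    using linear_order_on_ex_min[OF assms(1), of ?C] finite_subset[OF _ finite_D] by blast
  then have "f \<in> R n r" using assms(2) by (auto simp: R_def intro!: quotientI)
  moreover have "(f, x) \<in> sim n" using f(1) equiv_sim by (auto simp: equiv_def dest: symD)
  ultimately show ?thesis by blast
qed

text \<open>Two representatives of one orbit are each least in it, and antisymmetry identifies
  them.\<close>

lemma representative_unique:
  assumes "linear_order_on (D n) r" "f \<in> R n r" "g \<in> R n r" "(f, g) \<in> sim n"
  shows "f = g"
proof -
  have "(g, f) \<in> sim n" using assms(4) equiv_sim by (auto simp: equiv_def dest: symD)
  then have "(f, g) \<in> r" "(g, f) \<in> r" using assms R_minimal by blast+
  then show ?thesis using assms(1) by (auto simp: order_on_defs dest: antisymD)
qed

text \<open>\<open>S\<close> is the disjoint union of the orbits of the representatives it contains,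
  and \<open>h\<close> is constant on each orbit, whose size is \<open>gam n f\<close>.\<close>

lemma sum_orbits:
  fixes h :: "((nat \<Rightarrow> bool) \<Rightarrow> bool) \<Rightarrow> nat"
  assumes r: "linear_order_on (D n) r"
    and S: "S \<subseteq> D n" "\<And>f g. (f, g) \<in> sim n \<Longrightarrow> f \<in> S \<Longrightarrow> g \<in> S"
    and h: "\<And>f g. (f, g) \<in> sim n \<Longrightarrow> h f = h g"
  shows "sum h S = (\<Sum>f\<in>R n r \<inter> S. gam n f * h f)"
proof -
  have fin: "finite T" if "T \<subseteq> D n" for T using finite_subset[OF that finite_D] .
  have sim: "(g, f) \<in> sim n" if "(f, g) \<in> sim n" for f g
    using that equiv_sim by (auto simp: equiv_def dest: symD)
  have "S = (\<Union>f\<in>R n r \<inter> S. sim n `` {f})"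
  proof (intro equalityI subsetI)
    fix x assume x: "x \<in> S"
    then obtain f where "f \<in> R n r" "(f, x) \<in> sim n"
      using ex_representative[OF r] S(1) by blast
    then show "x \<in> (\<Union>f\<in>R n r \<inter> S. sim n `` {f})"
      using S(2)[OF sim] x by blast
  qed (use S(2) in blast)
  then have "sum h S = sum h (\<Union>f\<in>R n r \<inter> S. sim n `` {f})" by simp
  also have "\<dots> = (\<Sum>f\<in>R n r \<inter> S. sum h (sim n `` {f}))"
  proof (rule sum.UNION_disjoint)
    show "finite (R n r \<inter> S)" using S(1) by (intro fin) blast
    show "\<forall>f\<in>R n r \<inter> S. finite (sim n `` {f})" by (auto intro!: fin simp: sim_def)
    \<comment> \<open>Orbits that meet coincide, so their representatives would be equal.\<close>
    show "\<forall>f\<in>R n r \<inter> S. \<forall>g\<in>R n r \<inter> S. f \<noteq> g \<longrightarrow> sim n `` {f} \<inter> sim n `` {g} = {}"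
      using representative_unique[OF r] equiv_class_nondisjoint[OF equiv_sim] by blast
  qed
  also have "\<dots> = (\<Sum>f\<in>R n r \<inter> S. gam n f * h f)"
  proof (rule sum.cong[OF refl])
    fix f
    have "sum h (sim n `` {f}) = (\<Sum>g\<in>sim n `` {f}. h f)"
      by (rule sum.cong) (use h in auto)
    then show "sum h (sim n `` {f}) = gam n f * h f" by (simp add: gam_def)
  qed
  finally show ?thesis .
qed

section \<open>Discarding \<open>E\<close> modulo \<open>m\<close>\<close>

lemma gam_sim: "(f, g) \<in> sim n \<Longrightarrow> gam n f = gam n g"
  by (simp add: gam_def sim_Image_eq)

lemma E_sim: "(f, g) \<in> sim n \<Longrightarrow> f \<in> E n m \<Longrightarrow> g \<in> E n m"
  using gam_sim[of f g n] by (auto simp: E_def sim_def)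

lemma Ec_sim: "(f, g) \<in> sim n \<Longrightarrow> f \<in> Ec n m \<Longrightarrow> g \<in> Ec n m"
  using gam_sim[of f g n] by (auto simp: Ec_def E_def sim_def)

text \<open>After grouping by orbits every term has the factor \<open>gam n f\<close>, which
  \<open>m\<close> divides on \<open>E n m\<close>. The order \<open>r\<close> provides the
  representatives that index the orbits.\<close>

lemma sum_E_cong_0:
  fixes h :: "((nat \<Rightarrow> bool) \<Rightarrow> bool) \<Rightarrow> nat"
  assumes "linear_order_on (D n) r" "\<And>f g. (f, g) \<in> sim n \<Longrightarrow> h f = h g"
  shows "[sum h (E n m) = 0] (mod m)"
proof -
  have "sum h (E n m) = (\<Sum>f\<in>R n r \<inter> E n m. gam n f * h f)"
    using assms E_sim by (intro sum_orbits) (auto simp: E_def)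
  also have "m dvd \<dots>"
    by (rule dvd_sum) (auto simp: E_def cong_0_iff)
  finally show ?thesis by (simp add: cong_0_iff)
qed

lemma sum_D_cong_sum_Ec:
  fixes h :: "((nat \<Rightarrow> bool) \<Rightarrow> bool) \<Rightarrow> nat"
  assumes "linear_order_on (D n) r" "\<And>f g. (f, g) \<in> sim n \<Longrightarrow> h f = h g"
  shows "[sum h (D n) = sum h (Ec n m)] (mod m)"
proof -
  have "sum h (D n) = sum h (Ec n m) + sum h (E n m)"
    unfolding Ec_def by (rule sum.subset_diff) (auto simp: E_def finite_D)
  then show ?thesis
    using cong_add[OF cong_refl[of "sum h (Ec n m)"] sum_E_cong_0[OF assms]] by simp
qed

text \<open>If \<open>f = act p g\<close>, the substitution of \<open>act p y\<close> for
  \<open>y\<close> permutes the union of orbits \<open>S\<close>, and the diagonal invariance of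
  \<open>G\<close> then cancels \<open>p\<close>. This makes marginal sums of \<open>G\<close>
  admissible as the \<open>h\<close> of the orbit lemmas.\<close>

lemma sum_G_sim:
  assumes "(f, g) \<in> sim n" "S \<subseteq> D n"
    and S: "\<And>f g. (f, g) \<in> sim n \<Longrightarrow> f \<in> S \<Longrightarrow> g \<in> S"
  shows "(\<Sum>y\<in>S. G n f y) = (\<Sum>y\<in>S. G n g y)"
proof -
  from assms(1) obtain p where p: "p permutes {..<n}" "f = act p g"
    by (auto simp: sim_def)
  have in_S: "act q y \<in> S" if "y \<in> S" "q permutes {..<n}" for q y
  proof -
    have "(act q y, y) \<in> sim n" using that assms(2) by (auto simp: sim_def act_in_D)
    then have "(y, act q y) \<in> sim n" using equiv_sim by (auto simp: equiv_def dest: symD)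
    then show ?thesis using S that(1) by blast
  qed
  have "bij_betw (act p) S S"
    by (rule bij_betw_byWitness[where f' = "act (inv p)"])
      (auto simp: act_inv[OF p(1)] in_S p(1) permutes_inv)
  from sum.reindex_bij_betw[OF this, of "G n f"] show ?thesis
    by (simp add: p G_act)
qed

theorem theorem7:
  fixes n m :: nat
    and r :: "(((nat \<Rightarrow> bool) \<Rightarrow> bool) \<times> ((nat \<Rightarrow> bool) \<Rightarrow> bool)) set"
  assumes "m > 1"
    and "linear_order_on (D n) r"
  shows "[card (D (n + 2)) = G_sum n (D n \<times> D n)] (mod m)
    \<and> [G_sum n (D n \<times> D n) = G_sum n (Ec n m \<times> Ec n m)] (mod m)
    \<and> [card (D (n + 2)) = (\<Sum>x \<in> R n r \<inter> Ec n m. \<Sum>y \<in> Ec n m. gam n x * G n x y)] (mod m)"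
proof -
  have Ec: "Ec n m \<subseteq> D n" by (auto simp: Ec_def)
  note inv_D = sum_G_sim[OF _ subset_refl, of _ _ n]
  note inv_Ec = sum_G_sim[OF _ Ec Ec_sim]
  have "G_sum n (D n \<times> D n) = (\<Sum>x\<in>D n. \<Sum>y\<in>D n. G n x y)"
    by (simp add: G_sum_def sum.cartesian_product)
  also have "[\<dots> = (\<Sum>x\<in>Ec n m. \<Sum>y\<in>D n. G n x y)] (mod m)"
    by (rule sum_D_cong_sum_Ec[OF assms(2)], rule inv_D) (auto simp: sim_def)
  \<comment> \<open>Exchanging the sums and using the symmetry of \<open>G\<close> puts the argument
    still ranging over \<open>D n\<close> outside, so that the same reduction applies to it.\<close>
  also have "(\<Sum>x\<in>Ec n m. \<Sum>y\<in>D n. G n x y) = (\<Sum>y\<in>D n. \<Sum>x\<in>Ec n m. G n y x)"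
    by (subst sum.swap) (simp add: G_commute[of n _ _])
  also have "[\<dots> = (\<Sum>y\<in>Ec n m. \<Sum>x\<in>Ec n m. G n y x)] (mod m)"
    by (rule sum_D_cong_sum_Ec[OF assms(2)], rule inv_Ec)
  also have "(\<Sum>y\<in>Ec n m. \<Sum>x\<in>Ec n m. G n y x) = G_sum n (Ec n m \<times> Ec n m)"
    by (simp add: G_sum_def sum.cartesian_product)
  finally have main: "[G_sum n (D n \<times> D n) = G_sum n (Ec n m \<times> Ec n m)] (mod m)" .
  have "G_sum n (Ec n m \<times> Ec n m) = (\<Sum>x\<in>Ec n m. \<Sum>y\<in>Ec n m. G n x y)"
    by (simp add: G_sum_def sum.cartesian_product)
  \<comment> \<open>This grouping of the outer sum by orbits is an exact equality; the congruence
    comes solely from \<open>main\<close>.\<close>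
  also have "\<dots> = (\<Sum>x\<in>R n r \<inter> Ec n m. gam n x * (\<Sum>y\<in>Ec n m. G n x y))"
    by (rule sum_orbits[OF assms(2) Ec Ec_sim inv_Ec])
  also have "\<dots> = (\<Sum>x\<in>R n r \<inter> Ec n m. \<Sum>y\<in>Ec n m. gam n x * G n x y)"
    by (simp add: sum_distrib_left)
  finally show ?thesis using main by (simp only: card_D_add_2 cong_refl simp_thms)
qed

end
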